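(* Let $n,r$ be integers with $1<r<n$. (a) There exists a sequence $\{X_k\}\subset\mathbb{S}^{n,r}\setminus\mathbb{R}^{n\times r}_+$ such that $(X_k)_-\to 0$ and $$\operatorname{dist}(X_k,\mathbb{S}^{n,r}_+)\ge\frac1{\sqrt2}\|(X_k)_-\|_F^{1/2}.$$ (b) There exists a sequence $\{X_k\}\subset\mathbb{R}^{n\times r}_+\setminus\mathbb{S}^{n,r}$ such that $X_k^{T}X_k\to I_r$ and $$\operatorname{dist}(X_k,\mathbb{S}^{n,r}_+)\ge\frac1{\sqrt2}\|X_k^{T}X_k-I_r\|_F^{1/2}.$$ (c) There exists a sequence $\{X_k\}\subset\mathbb{R}^{n\times r}\setminus(\mathbb{R}^{n\times r}_+\cup\mathbb{S}^{n,r})$ such that $(X_k)_-\to0$, $X_k^{T}X_k\to I_r$, and $$\operatorname{dist}(X_k,\mathbb{S}^{n,r}_+)\ge\frac1{\sqrt2+1}\left(\|(X_k)_-\|_F^{1/2}+\|X_k^{T}X_k-I_r\|_F^{1/2}\right).$$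
   Context: $\mathbb{S}^{n,r}=\{X\in\mathbb{R}^{n\times r}:X^{T}X=I_r\}$ is the Stiefel manifold, $\mathbb{R}^{n\times r}_+$ is the set of entry-wise nonnegative matrices, and $\mathbb{S}^{n,r}_+=\mathbb{S}^{n,r}\cap\mathbb{R}^{n\times r}_+$ is the nonnegative Stiefel manifold. For a matrix $Y$, $Y_-=\max\{-Y,0\}$ entry-wise. $\|\cdot\|_F$ is the Frobenius norm and $\operatorname{dist}$ is the distance to a set in the Frobenius norm. *)

theory Defs
  imports "HOL-Analysis.Analysis"
begin

(* An n x r matrix has type real^'r^'n, with X $ i $ j the entry in row i and column j.
   The library norm on this type is the Frobenius norm (norm_matrix_eq_frobenius below, as the
   type carries the nested Euclidean norm), so infdist, the infimum of dist over a nonempty set,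
   is the Frobenius distance to that set. *)

definition stiefel :: "(real^'r^'n) set" where
  "stiefel = {X. transpose X ** X = mat 1}"

definition nonneg_matrices :: "(real^'r^'n) set" where
  "nonneg_matrices = {X. \<forall>i j. 0 \<le> X $ i $ j}"

definition nonneg_stiefel :: "(real^'r^'n) set" where
  "nonneg_stiefel = stiefel \<inter> nonneg_matrices"

definition neg_part :: "real^'r^'n \<Rightarrow> real^'r^'n" where
  "neg_part Y = (\<chi> i j. max (- (Y $ i $ j)) 0)"

lemma norm_matrix_eq_frobenius:
  fixes X :: "real^'r^'n"
  shows "norm X = sqrt (\<Sum>i\<in>UNIV. \<Sum>j\<in>UNIV. (X $ i $ j)\<^sup>2)"
  by (simp add: norm_vec_def L2_set_def sum_nonneg)

(* infdist to the empty set is 0 by convention; that case does not arise when r <= n. *)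
lemma nonneg_stiefel_nonempty:
  assumes "CARD('r) \<le> CARD('n)"
  shows "(nonneg_stiefel :: (real^'r^'n) set) \<noteq> {}"
proof -
  obtain f :: "'r \<Rightarrow> 'n" where f: "inj f"
    using card_le_inj[of "UNIV :: 'r set" "UNIV :: 'n set"] assms by auto
  define X :: "real^'r^'n" where "X = (\<chi> i j. if i = f j then 1 else 0)"
  have "transpose X ** X = mat 1"
    using f
    by (auto simp: X_def vec_eq_iff transpose_def matrix_matrix_mult_def mat_def inj_eq
        if_distrib [where f = "\<lambda>x. x * _"] cong: if_cong)
  then have "X \<in> nonneg_stiefel"
    by (auto simp: nonneg_stiefel_def stiefel_def nonneg_matrices_def X_def)
  then show ?thesis by blast
qed

end

theory Submission
  imports Defs
begin

text \<open>
  The distance can be as large as the square root of the constraint violation because a nonnegative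
  matrix with orthonormal columns must have columns with disjoint supports: the inner product of
  two columns is a sum of nonnegative
  terms, so it vanishes only if every term does. Hence a matrix with two entries at least
  \<open>\<epsilon>\<close> in one row stays at distance at least \<open>\<epsilon>\<close> from the nonnegative Stiefel manifold
  (\<open>infdist_nonneg_stiefel_ge\<close>), whereas these two entries contribute only \<open>\<epsilon>\<^sup>2\<close> to an inner
  product of columns.

  As \<open>r < n\<close>, there is a row \<open>a\<close> outside the image of an embedding \<open>f\<close> of the column indices
  into the row indices. Starting from the matrix with unit columns \<open>f j\<close>, two columns \<open>p\<close>
  and \<open>q\<close> are tilted so that both have the entry \<open>\<epsilon>\<close> in row \<open>a\<close>. In row \<open>f p\<close>, where column \<open>p\<close>
  has an entry \<open>s\<close> close to \<open>1\<close>, column \<open>q\<close> gets the entry \<open>-\<delta>\<close>. With the remaining entries,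
  in rows \<open>f p\<close> and \<open>f q\<close>, chosen so that both columns stay unit vectors, the negative part has
  norm \<open>\<delta>\<close>, and the Gram matrix deviates from the identity only by \<open>\<epsilon>\<^sup>2 - s \<delta>\<close>, in positions
  \<open>(p, q)\<close> and \<open>(q, p)\<close>. So \<open>\<delta>\<close> distributes a violation of order
  \<open>\<epsilon>\<^sup>2\<close> between the two constraints: \<open>\<delta> = \<epsilon>\<^sup>2 / s\<close> moves it all to the sign constraint,
  \<open>\<delta> = 0\<close> leaves it all in the orthogonality constraint, and \<open>\<delta> = \<epsilon>\<^sup>2 / 2\<close> shares it. These
  three choices, with \<open>\<epsilon>\<close> tending to \<open>0\<close>, give the three sequences. The constants follow from
  bounding the violations by \<open>2 \<epsilon>\<^sup>2\<close>, and by \<open>\<epsilon>\<^sup>2\<close> for the sign constraint in the third case.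
\<close>

section \<open>Distance to the nonnegative Stiefel manifold\<close>

lemma gram_entry:
  fixes X :: "real^'r^'n"
  shows "(transpose X ** X) $ j $ k = column j X \<bullet> column k X"
  by (simp add: matrix_matrix_mult_def transpose_def column_def inner_vec_def)

lemma nonneg_stiefel_disjoint_supports:
  fixes Z :: "real^'r^'n"
  assumes Z: "Z \<in> nonneg_stiefel" and "p \<noteq> q"
  shows "Z $ i $ p = 0 \<or> Z $ i $ q = 0"
proof -
  have nonneg: "0 \<le> Z $ i $ j" for i j
    using Z by (simp add: nonneg_stiefel_def nonneg_matrices_def)
  have "(transpose Z ** Z) $ p $ q = 0"
    using Z \<open>p \<noteq> q\<close> by (simp add: nonneg_stiefel_def stiefel_def mat_def)
  then have "(\<Sum>i\<in>UNIV. Z $ i $ p * Z $ i $ q) = 0"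
    by (simp add: gram_entry column_def inner_vec_def)
  then have "\<forall>i\<in>UNIV. Z $ i $ p * Z $ i $ q = 0"
    by (subst (asm) sum_nonneg_eq_0_iff) (auto simp: nonneg)
  then show ?thesis by simp
qed

lemma infdist_nonneg_stiefel_ge:
  fixes X :: "real^'r^'n"
  assumes "CARD('r) \<le> CARD('n)" and "p \<noteq> q"
    and "\<epsilon> \<le> X $ i $ p" and "\<epsilon> \<le> X $ i $ q"
  shows "\<epsilon> \<le> infdist X nonneg_stiefel"
proof -
  have "\<epsilon> \<le> dist X Z" if Z: "Z \<in> nonneg_stiefel" for Z
  proof -
    have entry: "\<bar>(X - Z) $ i $ j\<bar> \<le> dist X Z" for j
    proof -
      have "\<bar>(X - Z) $ i $ j\<bar> \<le> norm ((X - Z) $ i)"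
        by (rule component_le_norm_cart)
      also have "\<dots> \<le> norm (X - Z)"
        by (rule Finite_Cartesian_Product.norm_nth_le)
      finally show ?thesis
        by (simp add: dist_norm)
    qed
    show ?thesis
      using nonneg_stiefel_disjoint_supports[OF Z \<open>p \<noteq> q\<close>, of i] entry[of p] entry[of q] assms(3,4)
      by auto
  qed
  then show ?thesis
    using nonneg_stiefel_nonempty[OF assms(1)]
    by (auto simp: infdist_notempty intro!: cINF_greatest)
qed

section \<open>Tilting two columns of a matrix with unit columns\<close>

definition tilted_column :: "('r \<Rightarrow> 'n) \<Rightarrow> 'n \<Rightarrow> 'r \<Rightarrow> 'r \<Rightarrow> real \<Rightarrow> real \<Rightarrow> 'r \<Rightarrow> real^'n" where
  "tilted_column f a p q \<epsilon> \<delta> j =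
     (if j = p then \<epsilon> *\<^sub>R axis a 1 + sqrt (1 - \<epsilon>\<^sup>2) *\<^sub>R axis (f p) 1
      else if j = q then
        \<epsilon> *\<^sub>R axis a 1 - \<delta> *\<^sub>R axis (f p) 1 + sqrt (1 - \<epsilon>\<^sup>2 - \<delta>\<^sup>2) *\<^sub>R axis (f q) 1
      else axis (f j) 1)"

definition tilted_matrix :: "('r \<Rightarrow> 'n) \<Rightarrow> 'n \<Rightarrow> 'r \<Rightarrow> 'r \<Rightarrow> real \<Rightarrow> real \<Rightarrow> real^'r^'n" where
  "tilted_matrix f a p q \<epsilon> \<delta> = (\<chi> i j. tilted_column f a p q \<epsilon> \<delta> j $ i)"

lemma column_tilted_matrix [simp]:
  "column j (tilted_matrix f a p q \<epsilon> \<delta>) = tilted_column f a p q \<epsilon> \<delta> j"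
  by (simp add: tilted_matrix_def column_def vec_eq_iff)

lemma axis_nth_if: "axis i x $ j = (if j = i then x else 0)"
  by (simp add: axis_def)

text \<open>
  The bound \<open>\<epsilon>\<^sup>2 + \<delta>\<^sup>2 \<le> 1\<close> makes both radicands nonnegative, so that all columns are unit vectors.
  Columns \<open>p\<close> and \<open>q\<close> share the rows \<open>a\<close> and \<open>f p\<close>, and no other two columns share a row: these
  two rows produce the terms \<open>\<epsilon>\<^sup>2\<close> and \<open>- s \<delta>\<close> of the only nonzero off-diagonal entries.
\<close>

lemma gram_tilted_matrix:
  fixes f :: "'r::finite \<Rightarrow> 'n::finite"
  assumes "inj f" and a: "a \<notin> range f" and "p \<noteq> q" and le: "\<epsilon>\<^sup>2 + \<delta>\<^sup>2 \<le> 1"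
  defines "M \<equiv> tilted_matrix f a p q \<epsilon> \<delta>"
  shows "transpose M ** M - mat 1 =
    (\<epsilon>\<^sup>2 - sqrt (1 - \<epsilon>\<^sup>2) * \<delta>) *\<^sub>R (axis p (axis q 1) + axis q (axis p 1))"
proof -
  have a': "a \<noteq> f j" "f j \<noteq> a" for j
    using a by auto
  have "\<epsilon> * \<epsilon> \<le> 1" "\<delta> * \<delta> + \<epsilon> * \<epsilon> \<le> 1"
    using le zero_le_square[of \<delta>] unfolding power2_eq_square by linarith+
  then show ?thesis
    unfolding M_def vec_eq_iff
    using \<open>p \<noteq> q\<close>
    by (auto simp: gram_entry tilted_column_def mat_def inner_axis_axis axis_nth_if
        inj_eq[OF \<open>inj f\<close>] a' inner_add_left inner_add_right inner_diff_left inner_diff_right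
        power2_eq_square algebra_simps)
qed

text \<open>
  Of all entries only the \<open>-\<delta>\<close> can be negative. It is the sole contribution to its position, as
  \<open>f p\<close> differs from both \<open>a\<close> and \<open>f q\<close>.
\<close>

lemma neg_part_tilted_matrix:
  fixes f :: "'r::finite \<Rightarrow> 'n::finite"
  assumes "inj f" and a: "a \<notin> range f" and "p \<noteq> q" and le: "\<epsilon>\<^sup>2 + \<delta>\<^sup>2 \<le> 1"
    and "0 \<le> \<epsilon>" "0 \<le> \<delta>"
  shows "neg_part (tilted_matrix f a p q \<epsilon> \<delta>) = \<delta> *\<^sub>R axis (f p) (axis q 1)"
proof -
  have a': "a \<noteq> f j" "f j \<noteq> a" for j
    using a by auto
  have "0 \<le> 1 - \<epsilon>\<^sup>2" "0 \<le> 1 - \<epsilon>\<^sup>2 - \<delta>\<^sup>2"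
    using le zero_le_power2[of \<delta>] by linarith+
  then have s: "0 \<le> sqrt (1 - \<epsilon>\<^sup>2)" "0 \<le> sqrt (1 - \<epsilon>\<^sup>2 - \<delta>\<^sup>2)"
    by (simp_all only: real_sqrt_ge_zero)
  show ?thesis
    using \<open>p \<noteq> q\<close> s \<open>0 \<le> \<epsilon>\<close> \<open>0 \<le> \<delta>\<close>
    by (auto simp: vec_eq_iff neg_part_def tilted_matrix_def tilted_column_def axis_def
        inj_eq[OF \<open>inj f\<close>] a' max_def)
qed

lemma norm_gram_defect_tilted_matrix_le:
  fixes f :: "'r::finite \<Rightarrow> 'n::finite"
  assumes "inj f" and "a \<notin> range f" and "p \<noteq> q" and "\<epsilon>\<^sup>2 + \<delta>\<^sup>2 \<le> 1"
  defines "M \<equiv> tilted_matrix f a p q \<epsilon> \<delta>"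
  shows "norm (transpose M ** M - mat 1) \<le> 2 * \<bar>\<epsilon>\<^sup>2 - sqrt (1 - \<epsilon>\<^sup>2) * \<delta>\<bar>"
proof -
  have "norm (axis p (axis q 1) + axis q (axis p 1) :: real^'r^'r) \<le> 2"
    by (rule norm_triangle_le) simp
  then show ?thesis
    unfolding M_def gram_tilted_matrix[OF assms(1-4)]
    by (simp only: norm_scaleR) (metis abs_ge_zero mult.commute mult_left_mono)
qed

lemma tilted_matrix_in_stiefel_iff:
  fixes f :: "'r::finite \<Rightarrow> 'n::finite"
  assumes "inj f" and "a \<notin> range f" and "p \<noteq> q" and "\<epsilon>\<^sup>2 + \<delta>\<^sup>2 \<le> 1"
  shows "tilted_matrix f a p q \<epsilon> \<delta> \<in> stiefel \<longleftrightarrow> \<epsilon>\<^sup>2 = sqrt (1 - \<epsilon>\<^sup>2) * \<delta>"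
proof -
  have "(axis p (axis q 1) + axis q (axis p 1) :: real^'r^'r) $ p $ q = 1"
    using \<open>p \<noteq> q\<close> by (simp add: axis_def)
  then have "(axis p (axis q 1) + axis q (axis p 1) :: real^'r^'r) \<noteq> 0"
    by (metis zero_index zero_neq_one)
  then show ?thesis
    unfolding stiefel_def mem_Collect_eq
    using gram_tilted_matrix[OF assms]
    by (metis (no_types, lifting) eq_iff_diff_eq_0 scaleR_eq_0_iff)
qed

lemma nonneg_iff_neg_part_eq_0: "X \<in> nonneg_matrices \<longleftrightarrow> neg_part X = 0"
proof -
  have "max (- x) 0 = 0 \<longleftrightarrow> 0 \<le> x" for x :: real
    by linarith
  then show ?thesis
    by (simp add: nonneg_matrices_def neg_part_def vec_eq_iff)
qed

lemma tilted_matrix_in_nonneg_iff: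
  fixes f :: "'r::finite \<Rightarrow> 'n::finite"
  assumes "inj f" and "a \<notin> range f" and "p \<noteq> q" and "\<epsilon>\<^sup>2 + \<delta>\<^sup>2 \<le> 1" and "0 \<le> \<epsilon>" "0 \<le> \<delta>"
  shows "tilted_matrix f a p q \<epsilon> \<delta> \<in> nonneg_matrices \<longleftrightarrow> \<delta> = 0"
proof -
  have "(axis (f p) (axis q 1) :: real^'r^'n) \<noteq> 0"
    by (simp add: axis_eq_0_iff)
  then show ?thesis
    by (simp add: nonneg_iff_neg_part_eq_0 neg_part_tilted_matrix[OF assms])
qed

text \<open>
  Since \<open>a\<close> lies outside the range of \<open>f\<close>, no unit entry interferes with the two tilts \<open>\<epsilon>\<close> in
  row \<open>a\<close>; these violate disjointness of supports whatever \<open>\<delta>\<close> is.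
\<close>

lemma infdist_tilted_matrix_ge:
  fixes f :: "'r::finite \<Rightarrow> 'n::finite"
  assumes "inj f" and "a \<notin> range f" and "p \<noteq> q"
  shows "\<epsilon> \<le> infdist (tilted_matrix f a p q \<epsilon> \<delta>) nonneg_stiefel"
proof (rule infdist_nonneg_stiefel_ge[OF _ \<open>p \<noteq> q\<close>, where i = a])
  show "CARD('r) \<le> CARD('n)"
    using \<open>inj f\<close> by (metis card_image card_mono finite top_greatest)
qed (use assms in \<open>auto simp: tilted_matrix_def tilted_column_def axis_def\<close>)

section \<open>The three sequences\<close>

lemma sqrt_le_of_le_square:
  assumes "x \<le> c * \<epsilon>\<^sup>2" and "0 \<le> \<epsilon>"
  shows "sqrt x \<le> sqrt c * \<epsilon>"
  using real_sqrt_le_mono[OF assms(1)] assms(2) by (simp add: real_sqrt_mult)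

theorem proposition3:
  assumes "1 < CARD('r::finite)" and "CARD('r) < CARD('n::finite)"
  shows
    "(\<exists>X :: nat \<Rightarrow> real^'r^'n.
        (\<forall>k. X k \<in> stiefel - nonneg_matrices) \<and>
        (\<lambda>k. neg_part (X k)) \<longlonglongrightarrow> 0 \<and>
        (\<forall>k. infdist (X k) nonneg_stiefel \<ge> 1 / sqrt 2 * sqrt (norm (neg_part (X k))))) \<and>
     (\<exists>X :: nat \<Rightarrow> real^'r^'n.
        (\<forall>k. X k \<in> nonneg_matrices - stiefel) \<and>
        (\<lambda>k. transpose (X k) ** X k) \<longlonglongrightarrow> mat 1 \<and>
        (\<forall>k. infdist (X k) nonneg_stiefel \<ge>
           1 / sqrt 2 * sqrt (norm (transpose (X k) ** X k - mat 1)))) \<and>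
     (\<exists>X :: nat \<Rightarrow> real^'r^'n.
        (\<forall>k. X k \<in> UNIV - (nonneg_matrices \<union> stiefel)) \<and>
        (\<lambda>k. neg_part (X k)) \<longlonglongrightarrow> 0 \<and>
        (\<lambda>k. transpose (X k) ** X k) \<longlonglongrightarrow> mat 1 \<and>
        (\<forall>k. infdist (X k) nonneg_stiefel \<ge>
           1 / (sqrt 2 + 1) *
           (sqrt (norm (neg_part (X k))) + sqrt (norm (transpose (X k) ** X k - mat 1)))))"
proof -
  obtain f :: "'r \<Rightarrow> 'n" where f: "inj f"
    using card_le_inj[of "UNIV :: 'r set" "UNIV :: 'n set"] assms(2) by auto
  have "card (range f) < CARD('n)"
    using assms(2) by (simp add: card_image f)
  then obtain a where a: "a \<notin> range f"
    by (metis UNIV_eq_I less_irrefl)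
  obtain p q :: 'r where pq: "p \<noteq> q"
    using assms(1) by (metis UNIV_I One_nat_def card_1_singleton_iff card_le_Suc0_iff_eq
        finite leD)
  \<comment> \<open>The shift by \<open>2\<close> keeps \<open>\<epsilon> \<le> 1/2\<close>, hence \<open>s \<ge> 1/2\<close>, and so \<open>\<epsilon>\<^sup>2 / s \<le> 2 \<epsilon>\<^sup>2\<close>.\<close>
  define \<epsilon> :: "nat \<Rightarrow> real" where "\<epsilon> k = 1 / (real k + 2)" for k
  define s where "s k = sqrt (1 - (\<epsilon> k)\<^sup>2)" for k
  define M where "M \<delta> k = tilted_matrix f a p q (\<epsilon> k) (\<delta> k)" for \<delta> :: "nat \<Rightarrow> real" and k

  have \<epsilon>_pos: "0 < \<epsilon> k" for k
    by (simp add: \<epsilon>_def)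
  have \<epsilon>_sq: "(\<epsilon> k)\<^sup>2 \<le> 1/4" for k
    using power_mono[of "\<epsilon> k" "1/2" 2] \<epsilon>_pos[of k]
    by (simp add: \<epsilon>_def divide_simps power2_eq_square)
  have s_ge: "1/2 \<le> s k" for k
    unfolding s_def using \<epsilon>_sq[of k] by (intro real_le_rsqrt) (simp add: power2_eq_square)
  have s_le: "s k \<le> 1" for k
    unfolding s_def by simp
  have "\<epsilon> \<longlonglongrightarrow> 0"
    unfolding \<epsilon>_def by real_asymp
  then have "(\<lambda>k. 2 * (\<epsilon> k)\<^sup>2) \<longlonglongrightarrow> 0"
    by (auto intro!: tendsto_eq_intros)
  then have null: "Y \<longlonglongrightarrow> 0" if "\<And>k. norm (Y k) \<le> 2 * (\<epsilon> k)\<^sup>2" for Y :: "nat \<Rightarrow> real^'c^'d"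
    by (rule Lim_null_comparison[rotated]) (use that in simp)

  have le1: "(\<epsilon> k)\<^sup>2 + \<delta>\<^sup>2 \<le> 1" if "0 \<le> \<delta>" "\<delta> \<le> 2 * (\<epsilon> k)\<^sup>2" for \<delta> k
    using \<epsilon>_sq[of k] power_mono[of \<delta> "1/2" 2] that by (simp add: power2_eq_square)
  note M_simps = tilted_matrix_in_stiefel_iff[OF f a pq le1]
    tilted_matrix_in_nonneg_iff[OF f a pq le1]
  have norm_neg: "norm (neg_part (M \<delta> k)) = \<delta> k" if "0 \<le> \<delta> k" "\<delta> k \<le> 2 * (\<epsilon> k)\<^sup>2" for \<delta> k
    using neg_part_tilted_matrix[OF f a pq le1[OF that]] that \<epsilon>_pos[of k] by (simp add: M_def)
  have norm_gram: "norm (transpose (M \<delta> k) ** M \<delta> k - mat 1) \<le> 2 * (\<epsilon> k)\<^sup>2"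
    if "0 \<le> \<delta> k" "\<delta> k \<le> (\<epsilon> k)\<^sup>2" for \<delta> k
  proof -
    have "0 \<le> s k * \<delta> k" "s k * \<delta> k \<le> (\<epsilon> k)\<^sup>2"
      using that s_ge[of k] mult_right_mono[OF s_le[of k], of "\<delta> k"] by auto
    then show ?thesis
      using norm_gram_defect_tilted_matrix_le[OF f a pq le1[of "\<delta> k" k]] that
      by (simp add: M_def s_def)
  qed
  have dist: "\<epsilon> k \<le> infdist (M \<delta> k) nonneg_stiefel" for \<delta> k
    unfolding M_def by (rule infdist_tilted_matrix_ge[OF f a pq])
  have rate: "1 / sqrt 2 * sqrt x \<le> infdist (M \<delta> k) nonneg_stiefel" if "x \<le> 2 * (\<epsilon> k)\<^sup>2" for x \<delta> k
    using sqrt_le_of_le_square[OF that] \<epsilon>_pos[of k] dist[of k \<delta>]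
    by (simp add: field_simps)
      (smt (verit) mult_left_mono mult.commute real_sqrt_ge_zero)

  \<comment> \<open>all of the violation in the sign constraint\<close>
  define \<alpha> where "\<alpha> k = (\<epsilon> k)\<^sup>2 / s k" for k
  have \<alpha>: "0 < \<alpha> k" "\<alpha> k \<le> 2 * (\<epsilon> k)\<^sup>2" "s k * \<alpha> k = (\<epsilon> k)\<^sup>2" for k
  proof -
    have "0 < s k"
      using s_ge[of k] by simp
    then show "0 < \<alpha> k" "s k * \<alpha> k = (\<epsilon> k)\<^sup>2"
      using \<epsilon>_pos[of k] by (auto simp: \<alpha>_def)
    show "\<alpha> k \<le> 2 * (\<epsilon> k)\<^sup>2"
      using \<open>0 < s k\<close> mult_right_mono[OF s_ge[of k], of "2 * (\<epsilon> k)\<^sup>2"]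
      by (simp add: \<alpha>_def field_simps)
  qed
  have "M \<alpha> k \<in> stiefel - nonneg_matrices" for k
    using M_simps[of "\<alpha> k" k] \<alpha>[of k] \<epsilon>_pos[of k] by (simp add: M_def s_def)
  moreover have neg_\<alpha>: "norm (neg_part (M \<alpha> k)) \<le> 2 * (\<epsilon> k)\<^sup>2" for k
    using \<alpha>[of k] by (simp add: norm_neg)
  moreover have "(\<lambda>k. neg_part (M \<alpha> k)) \<longlonglongrightarrow> 0"
    using neg_\<alpha> by (intro null)
  ultimately have part_a: "(\<forall>k. M \<alpha> k \<in> stiefel - nonneg_matrices) \<and>
        (\<lambda>k. neg_part (M \<alpha> k)) \<longlonglongrightarrow> 0 \<and>
        (\<forall>k. infdist (M \<alpha> k) nonneg_stiefel \<ge> 1 / sqrt 2 * sqrt (norm (neg_part (M \<alpha> k))))"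
    using null rate by blast

  \<comment> \<open>all of the violation in the orthogonality constraint\<close>
  define \<beta> :: "nat \<Rightarrow> real" where "\<beta> k = 0" for k
  have "M \<beta> k \<in> nonneg_matrices - stiefel" for k
    using M_simps[of "\<beta> k" k] \<epsilon>_pos[of k] by (simp add: M_def \<beta>_def)
  moreover have gram_\<beta>: "norm (transpose (M \<beta> k) ** M \<beta> k - mat 1) \<le> 2 * (\<epsilon> k)\<^sup>2" for k
    by (rule norm_gram) (auto simp: \<beta>_def)
  moreover have "(\<lambda>k. transpose (M \<beta> k) ** M \<beta> k) \<longlonglongrightarrow> mat 1"
    using gram_\<beta> by (intro LIM_zero_cancel[OF null])
  ultimately have part_b: "(\<forall>k. M \<beta> k \<in> nonneg_matrices - stiefel) \<and>
        (\<lambda>k. transpose (M \<beta> k) ** M \<beta> k) \<longlonglongrightarrow> mat 1 \<and>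
        (\<forall>k. infdist (M \<beta> k) nonneg_stiefel \<ge>
           1 / sqrt 2 * sqrt (norm (transpose (M \<beta> k) ** M \<beta> k - mat 1)))"
    using rate by blast

  \<comment> \<open>the violation shared between the two constraints; as \<open>s \<le> 1\<close>, both parts are positive\<close>
  define \<gamma> where "\<gamma> k = (\<epsilon> k)\<^sup>2 / 2" for k
  have \<gamma>: "0 < \<gamma> k" "\<gamma> k \<le> (\<epsilon> k)\<^sup>2" "\<gamma> k \<le> 2 * (\<epsilon> k)\<^sup>2" for k
    using \<epsilon>_pos[of k] by (auto simp: \<gamma>_def)
  have "M \<gamma> k \<in> UNIV - (nonneg_matrices \<union> stiefel)" for k
  proof -
    have "s k * \<gamma> k \<le> 1 * \<gamma> k"
      using \<gamma>[of k] by (intro mult_right_mono s_le) simp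
    also have "\<dots> < (\<epsilon> k)\<^sup>2"
      using \<epsilon>_pos[of k] by (simp add: \<gamma>_def)
    finally have "(\<epsilon> k)\<^sup>2 \<noteq> s k * \<gamma> k"
      by simp
    then show ?thesis
      using M_simps[of "\<gamma> k" k] \<gamma>[of k] \<epsilon>_pos[of k] by (simp add: M_def s_def)
  qed
  moreover have neg_\<gamma>: "norm (neg_part (M \<gamma> k)) \<le> 1 * (\<epsilon> k)\<^sup>2" for k
    using \<gamma>[of k] by (simp add: norm_neg)
  moreover have gram_\<gamma>: "norm (transpose (M \<gamma> k) ** M \<gamma> k - mat 1) \<le> 2 * (\<epsilon> k)\<^sup>2" for k
    using \<gamma>[of k] by (intro norm_gram) auto
  moreover have "(\<lambda>k. neg_part (M \<gamma> k)) \<longlonglongrightarrow> 0"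
    using \<gamma> by (intro null) (simp add: norm_neg less_imp_le)
  moreover have "(\<lambda>k. transpose (M \<gamma> k) ** M \<gamma> k) \<longlonglongrightarrow> mat 1"
    using gram_\<gamma> by (intro LIM_zero_cancel[OF null])
  moreover have "1 / (sqrt 2 + 1) *
      (sqrt (norm (neg_part (M \<gamma> k))) + sqrt (norm (transpose (M \<gamma> k) ** M \<gamma> k - mat 1)))
      \<le> infdist (M \<gamma> k) nonneg_stiefel" for k
  proof -
    have "sqrt (norm (neg_part (M \<gamma> k))) + sqrt (norm (transpose (M \<gamma> k) ** M \<gamma> k - mat 1))
        \<le> (sqrt 2 + 1) * \<epsilon> k"
      using sqrt_le_of_le_square[OF neg_\<gamma>[of k]] sqrt_le_of_le_square[OF gram_\<gamma>[of k]]
        \<epsilon>_pos[of k] by (simp add: distrib_right)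
    also have "\<dots> \<le> (sqrt 2 + 1) * infdist (M \<gamma> k) nonneg_stiefel"
      by (intro mult_left_mono dist) simp
    finally show ?thesis
      by (simp add: divide_simps mult.commute add_pos_pos)
  qed
  ultimately have part_c: "(\<forall>k. M \<gamma> k \<in> UNIV - (nonneg_matrices \<union> stiefel)) \<and>
        (\<lambda>k. neg_part (M \<gamma> k)) \<longlonglongrightarrow> 0 \<and>
        (\<lambda>k. transpose (M \<gamma> k) ** M \<gamma> k) \<longlonglongrightarrow> mat 1 \<and>
        (\<forall>k. infdist (M \<gamma> k) nonneg_stiefel \<ge>
           1 / (sqrt 2 + 1) *
           (sqrt (norm (neg_part (M \<gamma> k))) + sqrt (norm (transpose (M \<gamma> k) ** M \<gamma> k - mat 1))))"
    by blast

  show ?thesis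
    using part_a part_b part_c by blast
qed

end
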